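(* Let $L$ be a finite-dimensional Lie algebra over a field $F$. Then (i) for every $x\in L$, the subalgebra $\langle x, Z^*(L)\rangle$ generated by $x$ and $Z^*(L)$ is nilpotent; (ii) if $F$ has characteristic zero, then $Z^*(L)=\mathrm{nil}(L)$.
   Context: $Z^*(L)$ is the hypercenter of $L$: the union of the upper central series $Z_0(L)=0$, $Z_i(L)/Z_{i-1}(L)=Z(L/Z_{i-1}(L))$. $\langle a,b\rangle$ denotes the Lie subalgebra generated by $a,b$, and $\mathrm{nil}(L)=\{x\in L\mid \langle h,x\rangle \text{ is nilpotent for all } h\in L\}$. *)

theory Defs
  imports Complex_Main
begin

definition lie_algebra :: "('k::field \<Rightarrow> 'v::ab_group_add \<Rightarrow> 'v) \<Rightarrow> ('v \<Rightarrow> 'v \<Rightarrow> 'v) \<Rightarrow> bool" where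
  "lie_algebra sc br \<longleftrightarrow>
     vector_space sc \<and>
     (\<forall>x y z. br (x + y) z = br x z + br y z) \<and>
     (\<forall>x y z. br x (y + z) = br x y + br x z) \<and>
     (\<forall>a x y. br (sc a x) y = sc a (br x y)) \<and>
     (\<forall>a x y. br x (sc a y) = sc a (br x y)) \<and>
     (\<forall>x. br x x = 0) \<and>
     (\<forall>x y z. br x (br y z) + br y (br z x) + br z (br x y) = 0)"

definition fin_dim :: "('k::field \<Rightarrow> 'v::ab_group_add \<Rightarrow> 'v) \<Rightarrow> bool" where
  "fin_dim sc \<longleftrightarrow> (\<exists>B. finite B \<and> module.span sc B = UNIV)"

text \<open>Upper central series: Z_0 = 0, Z_{i+1} = {x. [x,L] \<subseteq> Z_i}, i.e. Z_{i+1}/Z_i = Z(L/Z_i).\<close>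
fun upper_central :: "('v::ab_group_add \<Rightarrow> 'v \<Rightarrow> 'v) \<Rightarrow> nat \<Rightarrow> 'v set" where
  "upper_central br 0 = {0}"
| "upper_central br (Suc i) = {x. \<forall>y. br x y \<in> upper_central br i}"

definition hypercenter :: "('v::ab_group_add \<Rightarrow> 'v \<Rightarrow> 'v) \<Rightarrow> 'v set" where
  "hypercenter br = (\<Union>i. upper_central br i)"

definition lie_subalgebra :: "('k::field \<Rightarrow> 'v::ab_group_add \<Rightarrow> 'v) \<Rightarrow> ('v \<Rightarrow> 'v \<Rightarrow> 'v) \<Rightarrow> 'v set \<Rightarrow> bool" where
  "lie_subalgebra sc br A \<longleftrightarrow> module.subspace sc A \<and> (\<forall>x\<in>A. \<forall>y\<in>A. br x y \<in> A)"

definition gen_subalgebra :: "('k::field \<Rightarrow> 'v::ab_group_add \<Rightarrow> 'v) \<Rightarrow> ('v \<Rightarrow> 'v \<Rightarrow> 'v) \<Rightarrow> 'v set \<Rightarrow> 'v set" where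
  "gen_subalgebra sc br S = \<Inter>{A. S \<subseteq> A \<and> lie_subalgebra sc br A}"

fun lower_central :: "('k::field \<Rightarrow> 'v::ab_group_add \<Rightarrow> 'v) \<Rightarrow> ('v \<Rightarrow> 'v \<Rightarrow> 'v) \<Rightarrow> 'v set \<Rightarrow> nat \<Rightarrow> 'v set" where
  "lower_central sc br A 0 = A"
| "lower_central sc br A (Suc n) = module.span sc {br x y | x y. x \<in> A \<and> y \<in> lower_central sc br A n}"

definition nilpotent_sub :: "('k::field \<Rightarrow> 'v::ab_group_add \<Rightarrow> 'v) \<Rightarrow> ('v \<Rightarrow> 'v \<Rightarrow> 'v) \<Rightarrow> 'v set \<Rightarrow> bool" where
  "nilpotent_sub sc br A \<longleftrightarrow> (\<exists>n. lower_central sc br A n = {0})"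

definition nil_set :: "('k::field \<Rightarrow> 'v::ab_group_add \<Rightarrow> 'v) \<Rightarrow> ('v \<Rightarrow> 'v \<Rightarrow> 'v) \<Rightarrow> 'v set" where
  "nil_set sc br = {x. \<forall>h. nilpotent_sub sc br (gen_subalgebra sc br {h, x})}"

end

theory Submission
  imports Defs
begin

text \<open>
  The elements \<open>x\<close> killed by a power of every \<open>ad h\<close> form an ideal \<open>E\<close> in characteristic zero.
  Indeed \<open>(ad (h + t y))\<^sup>d x = 0\<close> with \<open>d = dim L\<close> for all scalars \<open>t\<close>, so the coefficient of \<open>t\<close>
  vanishes; taking \<open>y = [z,h]\<close>, this coefficient is the difference between
  \<open>ad z ((ad h)\<^sup>d x)\<close> and \<open>(ad h)\<^sup>d [z,x]\<close>, hence \<open>[z,x] \<in> E\<close>. By Engel's theorem for the action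
  of \<open>L\<close> on \<open>E\<close>, the ideal \<open>E\<close> lies in the hypercenter; and \<open>nil(L) \<subseteq> E\<close>.
  Conversely, the hypercenter is a term \<open>Z\<^sub>N\<close> of the upper central series, and the lower central
  series of \<open>F x + Z\<^sub>N\<close> descends through \<open>Z\<^sub>N, \<dots>, Z\<^sub>0 = 0\<close>.
\<close>

text \<open>The ascending series of \<open>L\<close> as a module over \<open>K\<close>: term i holds
  the elements killed by every product of i maps \<open>br a\<close> with \<open>a\<close> in
  \<open>K\<close>. Thus \<open>V \<subseteq> rel_upper_central br K k\<close> says that
  \<open>K\<close> acts nilpotently on \<open>V\<close>.\<close>

fun rel_upper_central :: "('v::ab_group_add \<Rightarrow> 'v \<Rightarrow> 'v) \<Rightarrow> 'v set \<Rightarrow> nat \<Rightarrow> 'v set" where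
  "rel_upper_central br K 0 = {0}"
| "rel_upper_central br K (Suc i) = {x. \<forall>a\<in>K. br a x \<in> rel_upper_central br K i}"

text \<open>\<open>ad_coeff br h y x m i\<close> is the coefficient of \<open>t\<^sup>i\<close> in \<open>(ad (h + t y))\<^sup>m x\<close>.\<close>

fun ad_coeff :: "('v::ab_group_add \<Rightarrow> 'v \<Rightarrow> 'v) \<Rightarrow> 'v \<Rightarrow> 'v \<Rightarrow> 'v \<Rightarrow> nat \<Rightarrow> nat \<Rightarrow> 'v" where
  "ad_coeff br h y x 0 0 = x"
| "ad_coeff br h y x 0 (Suc i) = 0"
| "ad_coeff br h y x (Suc m) 0 = br h (ad_coeff br h y x m 0)"
| "ad_coeff br h y x (Suc m) (Suc i) =
     br h (ad_coeff br h y x m (Suc i)) + br y (ad_coeff br h y x m i)"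

section \<open>Vector-valued polynomials that vanish identically\<close>

context vector_space
begin

text \<open>In the induction, p(2t) - 2^(n+1) p(t) loses the term of degree n+1, and its coefficient
  of t^i is multiplied by 2^i - 2^(n+1), which is nonzero in characteristic zero.\<close>

lemma polynomial_zero_imp_coeff_zero:
  assumes "CHAR('a) = 0" "\<And>t. (\<Sum>i\<le>n. scale (t ^ i) (c i)) = 0" "i \<le> n"
  shows "c i = 0"
  using assms(2,3)
proof (induction n arbitrary: c i)
  case 0
  from "0.prems"(1)[of 1] "0.prems"(2) show ?case by simp
next
  case (Suc n)
  let ?d = "\<lambda>i. scale (2 ^ i - 2 ^ Suc n) (c i)"
  have "(\<Sum>i\<le>n. scale (t ^ i) (?d i)) = 0" for t
  proof -
    have "(\<Sum>i\<le>n. scale (t ^ i) (?d i)) = (\<Sum>i\<le>Suc n. scale (t ^ i) (?d i))"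
      by simp
    also have "\<dots> = (\<Sum>i\<le>Suc n. scale ((2 * t) ^ i) (c i) - scale (2 ^ Suc n) (scale (t ^ i) (c i)))"
      by (rule sum.cong) (simp_all add: algebra_simps power_mult_distrib del: power_Suc)
    also have "\<dots> = (\<Sum>i\<le>Suc n. scale ((2 * t) ^ i) (c i))
        - scale (2 ^ Suc n) (\<Sum>i\<le>Suc n. scale (t ^ i) (c i))"
      by (simp only: sum_subtractf scale_sum_right)
    also have "\<dots> = 0" by (simp only: Suc.prems(1)) simp
    finally show ?thesis .
  qed
  then have d: "?d j = 0" if "j \<le> n" for j
    by (rule Suc.IH[where c = ?d]) (fact that)
  have c: "c j = 0" if "j \<le> n" for j
  proof -
    have "(of_nat (2 ^ j) :: 'a) \<noteq> of_nat (2 ^ Suc n)"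
      using that assms(1)
      by (subst of_nat_eq_iff_char_dvd) (auto intro!: power_strict_increasing simp del: power_Suc)
    then have "(2::'a) ^ j - 2 ^ Suc n \<noteq> 0" by simp
    with d[OF that] show ?thesis by (simp del: power_Suc)
  qed
  moreover have "c (Suc n) = 0" using Suc.prems(1)[of 1] c by simp
  ultimately show ?case using Suc.prems(2) le_Suc_eq by blast
qed

end

section \<open>Bracket identities and the upper central series\<close>

locale fin_dim_lie_algebra = finite_dimensional_vector_space sc Basis
  for sc :: "'k::field \<Rightarrow> 'v::ab_group_add \<Rightarrow> 'v" and Basis :: "'v set" +
  fixes br :: "'v \<Rightarrow> 'v \<Rightarrow> 'v"
  assumes lie: "lie_algebra sc br"
begin

lemma br_add_left: "br (x + y) z = br x z + br y z"
  and br_add_right: "br x (y + z) = br x y + br x z"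
  and br_scale_left: "br (sc a x) y = sc a (br x y)"
  and br_scale_right: "br x (sc a y) = sc a (br x y)"
  and br_self: "br x x = 0"
  and jacobi: "br x (br y z) + br y (br z x) + br z (br x y) = 0"
  using lie unfolding lie_algebra_def by blast+

lemma br_zero_left [simp]: "br 0 x = 0"
  using br_add_left[of 0 0 x] by simp

lemma br_zero_right [simp]: "br x 0 = 0"
  using br_add_right[of x 0 0] by simp

lemma br_minus_right: "br x (- y) = - br x y"
  using br_add_right[of x y "- y"] by (intro minus_unique[symmetric]) simp

lemma br_anticomm: "br x y = - br y x"
proof -
  have "br x y + br y x = br (x + y) (x + y)"
    unfolding br_add_left br_add_right by (simp add: br_self)
  then show ?thesis by (simp only: br_self eq_neg_iff_add_eq_0)
qed

lemma br_sum_right: "br x (sum f A) = (\<Sum>i\<in>A. br x (f i))"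
  by (induction A rule: infinite_finite_induct) (auto simp: br_add_right)

lemma br_derivation: "br x (br y z) = br (br x y) z + br y (br x z)"
proof -
  have "br y (br z x) = - br y (br x z)"
    by (simp only: br_anticomm[of z x] br_minus_right)
  then have "br x (br y z) - br y (br x z) - br (br x y) z = 0"
    using jacobi[of x y z] br_anticomm[of z "br x y"] by simp
  then show ?thesis by (simp add: algebra_simps)
qed

lemma subspace_upper_central: "subspace (upper_central br i)"
  by (induction i) (auto simp: subspace_def br_add_left br_scale_left)

lemma upper_central_Suc: "upper_central br i \<subseteq> upper_central br (Suc i)"
  by (induction i) auto

lemma upper_central_mono: "i \<le> j \<Longrightarrow> upper_central br i \<subseteq> upper_central br j"
  using lift_Suc_mono_le[of "upper_central br"] upper_central_Suc by blast

text \<open>The truncated \<open>i - 1\<close> is safe: for \<open>i = 0\<close> the bracket is zero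
  and stays in Z_0. Descending inductions may therefore run past the bottom.\<close>

lemma upper_central_br_right:
  assumes "x \<in> upper_central br i" shows "br y x \<in> upper_central br (i - 1)"
proof (cases i)
  case (Suc j)
  with assms have "br x y \<in> upper_central br j" by simp
  then show ?thesis
    using Suc br_anticomm[of y x] subspace_neg[OF subspace_upper_central] by simp
qed (use assms in simp)

lemma upper_central_br_left:
  assumes "x \<in> upper_central br i" shows "br x y \<in> upper_central br (i - 1)"
  using assms by (cases i) auto

text \<open>A term of largest dimension equals every later term, by comparison of dimensions, so the
  series is constant from there on.\<close>

lemma hypercenter_eq_upper_central:
  obtains N where "hypercenter br = upper_central br N"
proof -
  obtain N where N: "\<And>i. dim (upper_central br i) \<le> dim (upper_central br N)"
    using ex_has_greatest_nat[of "\<lambda>_. True" 0 "\<lambda>i. dim (upper_central br i)" "Suc dimension"]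
      dim_subset_UNIV le_imp_less_Suc by blast
  have "upper_central br i \<subseteq> upper_central br N" for i
  proof -
    let ?M = "upper_central br (max i N)"
    have "upper_central br N = ?M"
      using subspace_dim_equal[OF subspace_upper_central subspace_upper_central
          upper_central_mono[of N "max i N"] N] by simp
    then show ?thesis using upper_central_mono[of i "max i N"] by simp
  qed
  then have "hypercenter br = upper_central br N" unfolding hypercenter_def by blast
  then show ?thesis by (rule that)
qed

section \<open>Nilpotency of the subalgebra generated by an element and the hypercenter\<close>

lemma zero_in_lower_central: "0 \<in> A \<Longrightarrow> 0 \<in> lower_central sc br A n"
  by (cases n) (auto intro: span_zero)

lemma lower_central_mono: "A \<subseteq> B \<Longrightarrow> lower_central sc br A n \<subseteq> lower_central sc br B n"
proof (induction n)
  case (Suc n)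
  then have "{br x y |x y. x \<in> A \<and> y \<in> lower_central sc br A n}
      \<subseteq> {br x y |x y. x \<in> B \<and> y \<in> lower_central sc br B n}" by blast
  then show ?case by (simp add: span_mono)
qed simp

lemma zero_in_gen_subalgebra: "0 \<in> gen_subalgebra sc br S"
  unfolding gen_subalgebra_def lie_subalgebra_def by (auto intro: subspace_0)

lemma gen_subalgebra_mono: "S \<subseteq> T \<Longrightarrow> gen_subalgebra sc br S \<subseteq> gen_subalgebra sc br T"
  unfolding gen_subalgebra_def by blast

lemma gen_subalgebra_superset: "S \<subseteq> gen_subalgebra sc br S"
  unfolding gen_subalgebra_def by blast

lemma nilpotent_sub_subset:
  assumes "nilpotent_sub sc br B" "A \<subseteq> B" "0 \<in> A"
  shows "nilpotent_sub sc br A"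
proof -
  from assms(1) obtain n where "lower_central sc br B n = {0}"
    unfolding nilpotent_sub_def by blast
  then have "lower_central sc br A n = {0}"
    using lower_central_mono[OF assms(2), of n] zero_in_lower_central[OF assms(3), of n] by auto
  then show ?thesis unfolding nilpotent_sub_def by blast
qed

lemma nilpotent_gen_insert_hypercenter:
  "nilpotent_sub sc br (gen_subalgebra sc br (insert x (hypercenter br)))"
proof -
  obtain N where N: "hypercenter br = upper_central br N"
    by (rule hypercenter_eq_upper_central)
  define A where "A = {sc c x + z | c z. z \<in> upper_central br N}"
  note sub = subspace_upper_central[of N]
  \<comment> \<open>The multiples of \<open>x\<close> contribute only \<open>br x x = 0\<close> to
    each other, so a single bracket already lands in Z_N.\<close>
  have A: "br a b \<in> upper_central br N" if ab: "a \<in> A" "b \<in> A" for a b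
  proof -
    obtain c z d w where eq: "a = sc c x + z" "b = sc d x + w"
      and zw: "z \<in> upper_central br N" "w \<in> upper_central br N"
      using ab unfolding A_def by blast
    have "upper_central br (N - 1) \<subseteq> upper_central br N" by (rule upper_central_mono) simp
    then have "br x w \<in> upper_central br N" "br z x \<in> upper_central br N" "br z w \<in> upper_central br N"
      using zw upper_central_br_left upper_central_br_right by blast+
    then have "sc c (br x w) + sc d (br z x) + br z w \<in> upper_central br N"
      by (intro subspace_add[OF sub] subspace_scale[OF sub])
    also have "sc c (br x w) + sc d (br z x) + br z w = br a b"
      unfolding eq
      by (simp add: br_add_left br_add_right br_scale_left br_scale_right br_self algebra_simps)
    finally show ?thesis .
  qed
  have ZA: "upper_central br N \<subseteq> A"
    unfolding A_def using scale_zero_left by (smt (verit) add_0 mem_Collect_eq subsetI)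
  have "A = {u + z | u z. u \<in> span {x} \<and> z \<in> upper_central br N}"
    unfolding A_def span_singleton by blast
  then have "subspace A" using subspace_sums[OF subspace_span sub] by simp
  then have "lie_subalgebra sc br A"
    unfolding lie_subalgebra_def using A ZA by blast
  moreover have "x \<in> A"
    unfolding A_def using subspace_0[OF sub] by (smt (verit) add.right_neutral mem_Collect_eq scale_one)
  ultimately have gen: "gen_subalgebra sc br (insert x (hypercenter br)) \<subseteq> A"
    unfolding gen_subalgebra_def N using ZA by blast
  \<comment> \<open>One bracket is spent on entering Z_N, since \<open>x\<close> may lie outside it;
    each further one lowers the index. Hence N+1 brackets reach Z_0.\<close>
  have lc: "lower_central sc br A (Suc i) \<subseteq> upper_central br (N - i)" for i
  proof (induction i)
    case 0
    have "{br a b |a b. a \<in> A \<and> b \<in> A} \<subseteq> upper_central br N" using A by blast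
    then show ?case using span_minimal[OF _ sub] by simp
  next
    case (Suc i)
    have "{br a b |a b. a \<in> A \<and> b \<in> lower_central sc br A (Suc i)} \<subseteq> upper_central br (N - Suc i)"
      using Suc upper_central_br_right[of _ "N - i"] by auto
    then show ?case
      using span_minimal[OF _ subspace_upper_central] by (simp only: lower_central.simps(2)[of sc br A "Suc i"])
  qed
  have "lower_central sc br A (Suc N) = {0}"
    using lc[of N] zero_in_lower_central[OF subspace_0[OF \<open>subspace A\<close>], of "Suc N"] by auto
  then have "nilpotent_sub sc br A" unfolding nilpotent_sub_def by blast
  then show ?thesis using nilpotent_sub_subset gen zero_in_gen_subalgebra by blast
qed

text \<open>The first part is applied to \<open>h\<close> and not to \<open>x\<close>: the set
  \<open>{h, x}\<close> lies in \<open>insert h (hypercenter br)\<close>.\<close>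

lemma hypercenter_subset_nil_set: "hypercenter br \<subseteq> nil_set sc br"
proof
  fix x assume x: "x \<in> hypercenter br"
  have "nilpotent_sub sc br (gen_subalgebra sc br {h, x})" for h
    using nilpotent_sub_subset[OF nilpotent_gen_insert_hypercenter[of h]
        gen_subalgebra_mono zero_in_gen_subalgebra] x by simp
  then show "x \<in> nil_set sc br" unfolding nil_set_def by blast
qed

section \<open>Elements killed by a power of every inner derivation\<close>

lemma nil_set_ad_nilpotent:
  assumes "x \<in> nil_set sc br"
  shows "\<exists>n. (br h ^^ n) x = 0"
proof -
  let ?A = "gen_subalgebra sc br {h, x}"
  obtain n where n: "lower_central sc br ?A n = {0}"
    using assms unfolding nil_set_def nilpotent_sub_def by blast
  have hx: "h \<in> ?A" "x \<in> ?A" using gen_subalgebra_superset by blast+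
  have "(br h ^^ m) x \<in> lower_central sc br ?A m" for m
    by (induction m) (use hx in \<open>auto intro!: span_base\<close>)
  with n show ?thesis by blast
qed

text \<open>The kernels of the powers of \<open>br h\<close> grow strictly until they contain
  \<open>x\<close>, which takes at most \<open>dimension\<close> steps. The exponent becomes
  independent of \<open>h\<close>, as the expansion in h + t y requires.\<close>

lemma ad_pow_zero_dimension:
  assumes "(br h ^^ m) x = 0"
  shows "(br h ^^ dimension) x = 0"
proof (rule ccontr)
  assume neq: "(br h ^^ dimension) x \<noteq> 0"
  define S where "S i = {y. (br h ^^ i) y = 0}" for i
  have add: "(br h ^^ i) (y + z) = (br h ^^ i) y + (br h ^^ i) z" for i y z
    by (induction i) (auto simp: br_add_right)
  have scale: "(br h ^^ i) (sc c y) = sc c ((br h ^^ i) y)" for i c y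
    by (induction i) (auto simp: br_scale_right)
  have zero: "(br h ^^ i) 0 = 0" for i by (induction i) auto
  have sub: "subspace (S i)" for i
    unfolding S_def subspace_def by (simp add: add scale zero)
  have strict: "S i \<subset> S (Suc i)" if "i \<le> dimension" for i
  proof -
    define k where "k = (LEAST k. (br h ^^ k) x = 0)"
    have k: "(br h ^^ k) x = 0" unfolding k_def by (rule LeastI) (fact assms)
    have "i < k"
    proof (rule ccontr)
      assume "\<not> i < k"
      then have "(br h ^^ dimension) x = (br h ^^ (dimension - k)) ((br h ^^ k) x)"
        using that by (metis comp_apply funpow_add le_add_diff_inverse2 le_trans not_less)
      with k zero neq show False by simp
    qed
    then have eq: "Suc i + (k - Suc i) = k" "i + (k - Suc i) = k - 1" "k - 1 < k" by auto
    \<comment> \<open>As \<open>k\<close> is the least exponent that kills \<open>x\<close>, this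
      vector separates \<open>S i\<close> from \<open>S (Suc i)\<close>.\<close>
    have "(br h ^^ (k - Suc i)) x \<in> S (Suc i)"
      using k fun_cong[OF funpow_add[of "Suc i" "k - Suc i" "br h"], of x]
      unfolding S_def by (simp only: eq(1) comp_apply mem_Collect_eq)
    moreover have "(br h ^^ (k - 1)) x \<noteq> 0"
      using not_less_Least[of "k - 1" "\<lambda>k. (br h ^^ k) x = 0"] eq(3) unfolding k_def by blast
    then have "(br h ^^ (k - Suc i)) x \<notin> S i"
      using fun_cong[OF funpow_add[of i "k - Suc i" "br h"], of x]
      unfolding S_def by (simp only: eq(2) comp_apply mem_Collect_eq) simp
    moreover have "S i \<subseteq> S (Suc i)" unfolding S_def by auto
    ultimately show ?thesis by blast
  qed
  have "i \<le> Suc dimension \<Longrightarrow> i \<le> dim (S i)" for i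
  proof (induction i)
    case (Suc i)
    have "dim (S i) < dim (S (Suc i))"
      using strict[of i] Suc.prems sub by (intro dim_psubset) (simp add: span_eq_iff[THEN iffD2])
    with Suc show ?case by simp
  qed simp
  from this[of "Suc dimension"] dim_subset_UNIV[of "S (Suc dimension)"] show False by simp
qed

lemma ad_coeff_expansion:
  "(br (h + sc t y) ^^ m) x = (\<Sum>i\<le>m. sc (t ^ i) (ad_coeff br h y x m i))"
proof (induction m)
  case (Suc m)
  let ?c = "ad_coeff br h y x"
  \<comment> \<open>Coefficients beyond the degree vanish, so the sum of the \<open>br h\<close>
    terms can be extended to \<open>Suc m\<close> and aligned with the shifted sum of the
    \<open>br y\<close> terms.\<close>
  have top: "?c m j = 0" if "m < j" for m j
    using that
  proof (induction m arbitrary: j)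
    case 0
    then show ?case by (cases j) auto
  next
    case (Suc m)
    then show ?case by (cases j) auto
  qed
  have "(br (h + sc t y) ^^ Suc m) x =
      (\<Sum>i\<le>m. sc (t ^ i) (br h (?c m i))) + (\<Sum>i\<le>m. sc (t ^ Suc i) (br y (?c m i)))"
    by (simp add: Suc br_sum_right br_add_left br_scale_left br_scale_right scale_right_distrib
        scale_sum_right sum.distrib mult.commute)
  also have "(\<Sum>i\<le>m. sc (t ^ i) (br h (?c m i))) = (\<Sum>i\<le>Suc m. sc (t ^ i) (br h (?c m i)))"
    using top[of m "Suc m"] by simp
  also have "\<dots> = br h (?c m 0) + (\<Sum>i\<le>m. sc (t ^ Suc i) (br h (?c m (Suc i))))"
    by (subst sum.atMost_Suc_shift) simp
  finally have "(br (h + sc t y) ^^ Suc m) x = br h (?c m 0)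
      + (\<Sum>i\<le>m. sc (t ^ Suc i) (?c (Suc m) (Suc i)))"
    by (simp add: scale_right_distrib sum.distrib)
  also have "\<dots> = (\<Sum>i\<le>Suc m. sc (t ^ i) (?c (Suc m) i))"
    by (subst sum.atMost_Suc_shift) simp
  finally show ?case .
qed simp

lemma ad_coeff_0: "ad_coeff br h y x m 0 = (br h ^^ m) x"
  by (induction m) auto

text \<open>By the Leibniz rule, moving \<open>br z\<close> through \<open>br h ^^ m\<close> leaves
  the sum of all words in which one factor \<open>br h\<close> is replaced by
  \<open>br (br z h)\<close>. This sum is the coefficient of t in the m-th power of ad (h + t
  [z,h]), applied to \<open>x\<close>.\<close>

lemma br_ad_pow: "br z ((br h ^^ m) x) = (br h ^^ m) (br z x) + ad_coeff br h (br z h) x m 1"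
proof (induction m)
  case (Suc m)
  have "br z ((br h ^^ Suc m) x) = br (br z h) ((br h ^^ m) x) + br h (br z ((br h ^^ m) x))"
    by (simp add: br_derivation[of z h])
  then show ?case
    by (simp only: Suc) (simp add: br_add_right ad_coeff_0 algebra_simps)
qed simp

text \<open>The set E of the overview; in group-theoretic language, the right Engel
  elements.\<close>

definition engel_set :: "'v set" where
  "engel_set = {x. \<forall>h. \<exists>n. (br h ^^ n) x = 0}"

lemma engel_set_ideal:
  assumes "CHAR('k) = 0" "x \<in> engel_set"
  shows "br z x \<in> engel_set"
proof -
  \<comment> \<open>\<open>Suc\<close> keeps the linear coefficient within the degree bound even
    when \<open>dimension\<close> is 0.\<close>
  let ?d = "Suc dimension"
  have nil: "(br h ^^ ?d) x = 0" for h
  proof -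
    have "(br h ^^ dimension) x = 0"
      using assms(2) ad_pow_zero_dimension unfolding engel_set_def by blast
    then show ?thesis by simp
  qed
  have "(br h ^^ ?d) (br z x) = 0" for h
  proof -
    have "ad_coeff br h (br z h) x ?d 1 = 0"
      using polynomial_zero_imp_coeff_zero[where n = ?d and i = 1 and c = "ad_coeff br h (br z h) x ?d"]
        assms(1)
        ad_coeff_expansion[where y = "br z h" and m = ?d and x = x, symmetric] nil by auto
    then show ?thesis using br_ad_pow[where h = h and z = z and m = ?d and x = x] by (simp only: nil) simp
  qed
  then show ?thesis unfolding engel_set_def by blast
qed

section \<open>Engel's theorem for a set stable under brackets\<close>

lemma subspace_rel_upper_central: "subspace (rel_upper_central br K i)"
  by (induction i) (auto simp: subspace_def br_add_right br_scale_right)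

lemma rel_upper_central_mono:
  assumes "i \<le> j" shows "rel_upper_central br K i \<subseteq> rel_upper_central br K j"
proof -
  have "rel_upper_central br K i \<subseteq> rel_upper_central br K (Suc i)" for i
    by (induction i) auto
  then show ?thesis using lift_Suc_mono_le[of "rel_upper_central br K"] assms by blast
qed

lemma rel_upper_central_br:
  "\<lbrakk>x \<in> rel_upper_central br K i; a \<in> K\<rbrakk> \<Longrightarrow> br a x \<in> rel_upper_central br K (i - 1)"
  by (cases i) auto

lemma rel_upper_central_UNIV: "rel_upper_central br UNIV i \<subseteq> upper_central br i"
proof (induction i)
  case (Suc i)
  have "br x y \<in> upper_central br i" if "\<forall>a. br a x \<in> rel_upper_central br UNIV i" for x y
    using that Suc br_anticomm[of x y] subspace_neg[OF subspace_upper_central] by auto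
  then show ?case by auto
qed simp

text \<open>In [a,[y,x]] = [[a,y],x] + [y,[a,x]] the first term drops one level because [a,y] lies
  in \<open>K\<close>, and the second one does so by induction.\<close>

lemma rel_upper_central_normalizer:
  assumes "\<And>a. a \<in> K \<Longrightarrow> br a y \<in> K" "x \<in> rel_upper_central br K i"
  shows "br y x \<in> rel_upper_central br K i"
  using assms(2)
proof (induction i arbitrary: x)
  case (Suc i)
  have "br a (br y x) \<in> rel_upper_central br K i" if "a \<in> K" for a
    using Suc that assms(1)[OF that]
    by (subst br_derivation) (auto intro: subspace_add[OF subspace_rel_upper_central])
  then show ?case by simp
qed simp

text \<open>
  Grade the elements of \<open>L\<close> by how far they lower the filtration \<open>W\<^sub>j\<close> of \<open>V\<close>: all of \<open>L\<close> has degree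
  at least \<open>-k\<close>, bracketing with \<open>K\<close> raises the degree, and degree \<open>k\<close> forces \<open>V\<close> to be killed. An
  element outside \<open>K\<close> of the largest possible degree therefore normalizes \<open>K\<close>.
\<close>

lemma exists_normalizing_element:
  assumes V: "\<And>a x. x \<in> V \<Longrightarrow> br a x \<in> V"
    and K: "V \<subseteq> rel_upper_central br K k" "K \<noteq> UNIV"
    and centralizer: "\<And>z. (\<And>x. x \<in> V \<Longrightarrow> br z x = 0) \<Longrightarrow> z \<in> K"
  shows "\<exists>y. y \<notin> K \<and> (\<forall>a\<in>K. br a y \<in> K)"
proof -
  let ?W = "rel_upper_central br K"
  \<comment> \<open>\<open>P m\<close> consists of the elements of degree at least m - k; the shift
    by \<open>k\<close> keeps the index natural. Where \<open>k + j - m\<close> is truncated to 0,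
    the image is zero.\<close>
  define P where "P m = {z. \<forall>j. \<forall>x\<in>V \<inter> ?W j. br z x \<in> ?W (k + j - m)}" for m
  have P0: "P 0 = UNIV"
    unfolding P_def using V K(1) rel_upper_central_mono[of k "k + _" K] by fastforce
  have Pend: "P (k + k) \<subseteq> K"
  proof
    fix z assume "z \<in> P (k + k)"
    then have "br z x \<in> ?W (k + k - (k + k))" if "x \<in> V" for x
      using K(1) that unfolding P_def by blast
    then have "br z x = 0" if "x \<in> V" for x using that by simp
    then show "z \<in> K" by (rule centralizer)
  qed
  have step: "br a z \<in> P (Suc m)" if az: "a \<in> K" "z \<in> P m" for a z m
    unfolding P_def
  proof (intro CollectI allI ballI)
    fix j x assume x: "x \<in> V \<inter> ?W j"
    show "br (br a z) x \<in> ?W (k + j - Suc m)"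
    \<comment> \<open>For positive \<open>j\<close>, bracketing \<open>x\<close> with
      \<open>a\<close> lowers its level by one, which accounts for \<open>Suc m\<close>. Level 0
      cannot be lowered, but there \<open>x\<close> is zero.\<close>
    proof (cases j)
      case (Suc i)
      have "br z x \<in> ?W (k + j - m)" using az x unfolding P_def by blast
      then have 1: "br a (br z x) \<in> ?W (k + j - Suc m)"
        using rel_upper_central_br[OF _ az(1)] by fastforce
      have "br a x \<in> V \<inter> ?W i" using x Suc V az(1) by simp
      then have 2: "br z (br a x) \<in> ?W (k + j - Suc m)"
        using az(2) Suc unfolding P_def by fastforce
      have "br (br a z) x = br a (br z x) - br z (br a x)"
        using br_derivation[of a z x] by simp
      then show ?thesis using subspace_diff[OF subspace_rel_upper_central 1 2] by simp
    qed (use x subspace_0[OF subspace_rel_upper_central] in simp)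
  qed
  define m where "m = (LEAST m. P m \<subseteq> K)"
  have m: "P m \<subseteq> K" unfolding m_def by (rule LeastI) (fact Pend)
  have "m \<noteq> 0" using m P0 K(2) by auto
  then have "\<not> P (m - 1) \<subseteq> K"
    using not_less_Least[of "m - 1" "\<lambda>m. P m \<subseteq> K"] unfolding m_def by simp
  then obtain y where y: "y \<in> P (m - 1)" "y \<notin> K" by blast
  have "br a y \<in> K" if "a \<in> K" for a
    using step[OF that y(1)] m \<open>m \<noteq> 0\<close> by auto
  with y(2) show ?thesis by blast
qed

text \<open>Each level for \<open>K\<close> is refined into \<open>n\<close> levels for
  \<open>K'\<close> along the chain x, [y,x], [y,[y,x]], ..., which ends in 0 after \<open>n\<close>
  steps and is climbed backwards. On each member, \<open>y\<close> moves to the next one, while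
  \<open>K\<close> drops into level \<open>j\<close>, treated before.\<close>

lemma rel_upper_central_extend:
  assumes V: "\<And>a x. x \<in> V \<Longrightarrow> br a x \<in> V"
    and y: "\<And>a. a \<in> K \<Longrightarrow> br a y \<in> K" "\<And>x. x \<in> V \<Longrightarrow> (br y ^^ n) x = 0"
    and K': "K' = {a + sc c y | a c. a \<in> K}"
  shows "V \<inter> rel_upper_central br K j \<subseteq> rel_upper_central br K' (n * j)"
proof (induction j)
  case (Suc j)
  let ?W = "rel_upper_central br K" and ?W' = "rel_upper_central br K'"
  show ?case
  proof
    fix x assume x: "x \<in> V \<inter> ?W (Suc j)"
    have inv: "(br y ^^ i) x \<in> V \<inter> ?W (Suc j)" for i
    proof (induction i)
      case (Suc i)
      then show ?case using V rel_upper_central_normalizer[OF y(1)] by (simp del: rel_upper_central.simps)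
    qed (use x in simp)
    have "i \<le> n \<Longrightarrow> (br y ^^ (n - i)) x \<in> ?W' (n * j + i)" for i
    proof (induction i)
      case 0
      then show ?case using y(2) x subspace_0[OF subspace_rel_upper_central] by simp
    next
      case (Suc i)
      let ?u = "(br y ^^ (n - Suc i)) x"
      have "br b ?u \<in> ?W' (n * j + i)" if "b \<in> K'" for b
      proof -
        obtain a c where b: "b = a + sc c y" "a \<in> K" using \<open>b \<in> K'\<close> unfolding K' by blast
        have "br a ?u \<in> V \<inter> ?W j" using inv[of "n - Suc i"] V b(2) by simp
        then have 1: "br a ?u \<in> ?W' (n * j + i)"
          using Suc.IH \<open>V \<inter> ?W j \<subseteq> ?W' (n * j)\<close> rel_upper_central_mono[of "n * j" "n * j + i"] by auto
        have "br y ?u = (br y ^^ (n - i)) x"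
          using Suc.prems by (metis Suc_diff_Suc Suc_le_eq comp_apply funpow.simps(2))
        then have 2: "br y ?u \<in> ?W' (n * j + i)" using Suc by simp
        show ?thesis
          unfolding b(1) br_add_left br_scale_left
          by (intro subspace_add[OF subspace_rel_upper_central] 1
              subspace_scale[OF subspace_rel_upper_central] 2)
      qed
      then show ?case by simp
    qed
    from this[of n] show "x \<in> ?W' (n * Suc j)" by (simp add: add.commute)
  qed
qed auto

text \<open>Among the subalgebras that contain the centralizer \<open>C\<close> of \<open>V\<close>
  and act nilpotently on \<open>V\<close>, one of largest dimension is all of \<open>L\<close>:
  otherwise a normalizing element \<open>y\<close> outside it could be adjoined. Containing
  \<open>C\<close> is what makes such a \<open>y\<close> available.\<close>

lemma engel:
  assumes V: "\<And>a x. x \<in> V \<Longrightarrow> br a x \<in> V"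
    and nil: "\<And>h x. x \<in> V \<Longrightarrow> (br h ^^ n) x = 0"
  shows "\<exists>k. V \<subseteq> rel_upper_central br UNIV k"
proof -
  define C where "C = {z. \<forall>x\<in>V. br z x = 0}"
  define good where "good K \<longleftrightarrow> lie_subalgebra sc br K \<and> C \<subseteq> K
      \<and> (\<exists>k. V \<subseteq> rel_upper_central br K k)" for K
  have "lie_subalgebra sc br C"
    unfolding lie_subalgebra_def C_def subspace_def
  proof (intro conjI ballI CollectI)
    fix z w x assume zw: "z \<in> {z. \<forall>x\<in>V. br z x = 0}" "w \<in> {z. \<forall>x\<in>V. br z x = 0}" "x \<in> V"
    then show "br (br z w) x = 0"
      using br_derivation[of z w x] by simp
  qed (auto simp: br_add_left br_scale_left)
  \<comment> \<open>\<open>C\<close> kills \<open>V\<close> in one step, so it is a first candidate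
    for the maximal choice.\<close>
  moreover have "V \<subseteq> rel_upper_central br C 1" unfolding C_def by auto
  ultimately have "good C" unfolding good_def by blast
  moreover have "\<forall>K. good K \<longrightarrow> dim K < Suc dimension"
    using dim_subset_UNIV by (simp add: less_Suc_eq_le)
  ultimately obtain K where K: "good K" and max: "\<And>K'. good K' \<Longrightarrow> dim K' \<le> dim K"
    using ex_has_greatest_nat[of good C dim] by metis
  from K obtain k where k: "V \<subseteq> rel_upper_central br K k"
    and K_sub: "subspace K" "\<And>a b. a \<in> K \<Longrightarrow> b \<in> K \<Longrightarrow> br a b \<in> K" and CK: "C \<subseteq> K"
    unfolding good_def lie_subalgebra_def by blast
  have "K = UNIV"
  proof (rule ccontr)
    assume "K \<noteq> UNIV"
    have CV: "z \<in> K" if "\<And>x. x \<in> V \<Longrightarrow> br z x = 0" for z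
      using that CK unfolding C_def by blast
    have "\<exists>y. y \<notin> K \<and> (\<forall>a\<in>K. br a y \<in> K)"
      using V k \<open>K \<noteq> UNIV\<close> CV by (rule exists_normalizing_element)
    then obtain y where y: "y \<notin> K" "\<And>a. a \<in> K \<Longrightarrow> br a y \<in> K" by blast
    define K' where "K' = {a + sc c y | a c. a \<in> K}"
    have "K' = {a + u | a u. a \<in> K \<and> u \<in> span {y}}"
      unfolding K'_def span_singleton by blast
    then have sub: "subspace K'" using subspace_sums[OF K_sub(1) subspace_span] by simp
    have KK': "K \<subseteq> K'"
      unfolding K'_def by (smt (verit) add.right_neutral mem_Collect_eq scale_zero_left subsetI)
    have "y \<in> K'"
      unfolding K'_def using subspace_0[OF K_sub(1)] by (smt (verit) add_0 mem_Collect_eq scale_one)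
    have "br u v \<in> K'" if in_K': "u \<in> K'" "v \<in> K'" for u v
    proof -
      obtain a c b d where uv: "u = a + sc c y" "v = b + sc d y" "a \<in> K" "b \<in> K"
        using in_K' unfolding K'_def by blast
      have yb: "br y b \<in> K" using y(2)[OF uv(4)] br_anticomm[of y b] subspace_neg[OF K_sub(1)] by simp
      have "br a b + sc d (br a y) + sc c (br y b) \<in> K"
        by (intro subspace_add[OF K_sub(1)] subspace_scale[OF K_sub(1)]
            K_sub(2)[OF uv(3,4)] y(2)[OF uv(3)] yb)
      also have "br a b + sc d (br a y) + sc c (br y b) = br u v"
        unfolding uv
        by (simp add: br_add_left br_add_right br_scale_left br_scale_right br_self algebra_simps)
      finally show ?thesis using KK' by blast
    qed
    then have "lie_subalgebra sc br K'" using sub unfolding lie_subalgebra_def by blast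
    moreover have "V \<inter> rel_upper_central br K k \<subseteq> rel_upper_central br K' (n * k)"
      using V y(2) nil K'_def by (rule rel_upper_central_extend)
    ultimately have "good K'" unfolding good_def using CK KK' k by blast
    then have "dim K' \<le> dim K" by (rule max)
    then have "K = K'" by (rule subspace_dim_equal[OF K_sub(1) sub KK'])
    with y(1) \<open>y \<in> K'\<close> show False by blast
  qed
  with k show ?thesis by blast
qed

section \<open>The inclusion of nil(L) in the hypercenter, and the conclusion\<close>

lemma nil_set_subset_hypercenter:
  assumes "CHAR('k) = 0"
  shows "nil_set sc br \<subseteq> hypercenter br"
proof -
  have "nil_set sc br \<subseteq> engel_set"
    unfolding engel_set_def using nil_set_ad_nilpotent by blast
  moreover have "(br h ^^ dimension) x = 0" if "x \<in> engel_set" for h x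
    using that ad_pow_zero_dimension unfolding engel_set_def by blast
  then obtain k where "engel_set \<subseteq> rel_upper_central br UNIV k"
    using engel[of engel_set] engel_set_ideal[OF assms] by blast
  ultimately show ?thesis
    using rel_upper_central_UNIV unfolding hypercenter_def by blast
qed

end

text \<open>A maximal independent subset of the finite spanning set supplies the basis that the
  locale takes as a parameter.\<close>

lemma fin_dim_lie_algebra_exists:
  assumes "lie_algebra sc br" "fin_dim sc"
  obtains B where "fin_dim_lie_algebra sc B br"
proof -
  interpret vector_space sc using assms(1) unfolding lie_algebra_def by blast
  obtain S where S: "finite S" "span S = UNIV" using assms(2) unfolding fin_dim_def by blast
  obtain B where B: "B \<subseteq> S" "independent B" "S \<subseteq> span B"
    using maximal_independent_subset[of S] by blast
  have "span B = UNIV" using B(3) S(2) span_minimal[OF B(3) subspace_span] by blast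
  then have "fin_dim_lie_algebra sc B br"
    using B S(1) assms(1) finite_subset by unfold_locales auto
  then show ?thesis by (rule that)
qed

theorem theorem3p4:
  fixes sc :: "'k::field \<Rightarrow> 'v::ab_group_add \<Rightarrow> 'v"
    and br :: "'v \<Rightarrow> 'v \<Rightarrow> 'v"
  assumes "lie_algebra sc br"
    and "fin_dim sc"
  shows "(\<forall>x. nilpotent_sub sc br (gen_subalgebra sc br (insert x (hypercenter br))))
         \<and> (CHAR('k) = 0 \<longrightarrow> hypercenter br = nil_set sc br)"
proof -
  obtain B where "fin_dim_lie_algebra sc B br"
    using assms by (rule fin_dim_lie_algebra_exists)
  then interpret fin_dim_lie_algebra sc B br .
  show ?thesis
    using nilpotent_gen_insert_hypercenter hypercenter_subset_nil_set nil_set_subset_hypercenter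
    by blast
qed

end
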